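(* Let $\lambda,\mu,\alpha,\beta\in\mathbb{C}^*$ and $a,b\in\mathbb{C}$. Then $S(\lambda,\alpha,a)\cong S(\mu,\beta,b)$ as modules over the Ramond $N=2$ superconformal algebra $\mathcal{R}$ if and only if $\lambda=\mu$ and $a=b$.
   Context: The base field is $\mathbb{C}$; $\mathbb{C}^*$ is the set of nonzero complex numbers. The Ramond $N=2$ superconformal algebra $\mathcal{R}$ is the Lie superalgebra with basis $\{L_m,H_m,G_m^{+},G_m^{-},C\mid m\in\mathbb{Z}\}$, where $L_m,H_m,C$ are even, $G_m^{\pm}$ are odd, and, for $m,n,r,s\in\mathbb{Z}$, $[L_m,L_n]=(m-n)L_{m+n}+\frac1{12}(m^3-m)\delta_{m+n,0}C$, $[L_m,H_n]=-nH_{m+n}$, $[H_m,H_n]=\frac13 m\delta_{m+n,0}C$, $[L_m,G_r^{\pm}]=(\frac12 m-r)G_{m+r}^{\pm}$, $[H_m,G_r^{\pm}]=\pm G_{m+r}^{\pm}$, $[G_r^-,G_s^+]=2L_{r+s}-(r-s)H_{r+s}+\frac13(r^2-\frac14)\delta_{r+s,0}C$, $[G_r^+,G_s^+]=[G_r^-,G_s^-]=0$, $[\mathcal{R},C]=0$. A module over a Lie superalgebra always means a supermodule ($\mathbb{Z}_2$-graded, with the action compatible with the grading). For $\lambda,\alpha\in\mathbb{C}^*$ and $a\in\mathbb{C}$, $S(\lambda,\alpha,a)=\mathbb{C}[x]\oplus\mathbb{C}[s]$ is the $\mathcal{R}$-module with even part $\mathbb{C}[x]$, odd part $\mathbb{C}[s]$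 and action, for $m\in\mathbb{Z}$, $f\in\mathbb{C}[x]$, $g\in\mathbb{C}[s]$: $L_m f(x)=\lambda^m(x-\frac12 ma)f(x+m)$, $L_m g(s)=\lambda^m(s-\frac12 ma+\frac12 m)g(s+m)$, $H_m f(x)=-a\lambda^m f(x+m)$, $H_m g(s)=-(a+1)\lambda^m g(s+m)$, $G_m^+f(x)=0$, $G_m^+g(s)=\lambda^m\frac2\alpha(x-ma)g(x+m)$, $G_m^-f(x)=\lambda^m\alpha f(s+m)$, $G_m^-g(s)=0$, $Cf=Cg=0$. *)

theory Defs
  imports Complex_Main "HOL-Library.Z2" "HOL-Library.Poly_Mapping" "HOL-Library.Product_Plus"
    "HOL-Computational_Algebra.Polynomial"
begin

section \<open>Lie superalgebras and their supermodules over the complex numbers\<close>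

locale super_vector_space = vector_space scale
  for scale :: "complex \<Rightarrow> 'v::ab_group_add \<Rightarrow> 'v"
    and part :: "bit \<Rightarrow> 'v set" +
  assumes subspace_part: "subspace (part i)"
    and direct_sum: "\<exists>!p. fst p \<in> part 0 \<and> snd p \<in> part 1 \<and> v = fst p + snd p"

definition koszul_sign :: "bit \<Rightarrow> bit \<Rightarrow> complex" where
  "koszul_sign i j = (if i = 1 \<and> j = 1 then - 1 else 1)"

locale lie_superalgebra = super_vector_space gscale gpart
  for gscale :: "complex \<Rightarrow> 'g::ab_group_add \<Rightarrow> 'g"
    and gpart :: "bit \<Rightarrow> 'g set" +
  fixes br :: "'g \<Rightarrow> 'g \<Rightarrow> 'g"
  assumes br_linear_left: "Vector_Spaces.linear gscale gscale (\<lambda>u. br u v)"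
    and br_linear_right: "Vector_Spaces.linear gscale gscale (br u)"
    and br_graded: "\<lbrakk>u \<in> gpart i; v \<in> gpart j\<rbrakk> \<Longrightarrow> br u v \<in> gpart (i + j)"
    and br_skew: "\<lbrakk>u \<in> gpart i; v \<in> gpart j\<rbrakk> \<Longrightarrow> br u v = - gscale (koszul_sign i j) (br v u)"
    and br_jacobi: "\<lbrakk>u \<in> gpart i; v \<in> gpart j\<rbrakk> \<Longrightarrow>
      br u (br v w) = br (br u v) w + gscale (koszul_sign i j) (br v (br u w))"

record ('g, 'v) supermodule =
  scal :: "complex \<Rightarrow> 'v \<Rightarrow> 'v"
  part :: "bit \<Rightarrow> 'v set"
  act :: "'g \<Rightarrow> 'v \<Rightarrow> 'v"

locale lie_supermodule =
  lie_superalgebra gscale gpart br + M: super_vector_space "scal M" "part M"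
  for gscale :: "complex \<Rightarrow> 'g::ab_group_add \<Rightarrow> 'g"
    and gpart :: "bit \<Rightarrow> 'g set"
    and br :: "'g \<Rightarrow> 'g \<Rightarrow> 'g"
    and M :: "('g, 'v::ab_group_add) supermodule" +
  assumes act_linear_left: "Vector_Spaces.linear gscale (scal M) (\<lambda>u. act M u v)"
    and act_linear_right: "Vector_Spaces.linear (scal M) (scal M) (act M u)"
    and act_graded: "\<lbrakk>u \<in> gpart i; v \<in> part M j\<rbrakk> \<Longrightarrow> act M u v \<in> part M (i + j)"
    and act_bracket: "\<lbrakk>u \<in> gpart i; u' \<in> gpart j\<rbrakk> \<Longrightarrow>
      act M (br u u') v
        = act M u (act M u' v) - scal M (koszul_sign i j) (act M u' (act M u v))"

text \<open>Isomorphisms of supermodules are even, i.e. they preserve the grading.\<close>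

definition (in lie_superalgebra) isomorphic ::
  "('g, 'v::ab_group_add) supermodule \<Rightarrow> ('g, 'w::ab_group_add) supermodule \<Rightarrow> bool" where
  "isomorphic M N \<longleftrightarrow>
     lie_supermodule gscale gpart br M \<and> lie_supermodule gscale gpart br N \<and>
     (\<exists>\<phi>. Vector_Spaces.linear (scal M) (scal N) \<phi> \<and> bij \<phi> \<and>
          (\<forall>i. \<phi> ` part M i = part N i) \<and>
          (\<forall>u v. \<phi> (act M u v) = act N u (\<phi> v)))"


section \<open>The Ramond $N=2$ superconformal algebra\<close>

datatype basis = L int | H int | Gplus int | Gminus int | Cent

fun parity :: "basis \<Rightarrow> bit" where
  "parity (L m) = 0"
| "parity (H m) = 0"
| "parity (Gplus m) = 1"
| "parity (Gminus m) = 1"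
| "parity Cent = 0"

type_synonym ramond = "basis \<Rightarrow>\<^sub>0 complex"

definition cscale :: "complex \<Rightarrow> ('b \<Rightarrow>\<^sub>0 complex) \<Rightarrow> ('b \<Rightarrow>\<^sub>0 complex)" where
  "cscale c u = Poly_Mapping.map ((*) c) u"

definition linear_extension ::
  "(complex \<Rightarrow> 'v \<Rightarrow> 'v) \<Rightarrow> ('b \<Rightarrow> 'v) \<Rightarrow> ('b \<Rightarrow>\<^sub>0 complex) \<Rightarrow> 'v::comm_monoid_add" where
  "linear_extension sc f u = (\<Sum>i\<in>Poly_Mapping.keys u. sc (Poly_Mapping.lookup u i) (f i))"

definition ramond_part :: "bit \<Rightarrow> ramond set" where
  "ramond_part i = {u. \<forall>b\<in>Poly_Mapping.keys u. parity b = i}"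

definition central :: "int \<Rightarrow> complex \<Rightarrow> ramond" where
  "central k c = Poly_Mapping.single Cent (if k = 0 then c else 0)"

text \<open>The equations with the two generators in the opposite order are those forced by super
  skew-symmetry.\<close>

fun basis_bracket :: "basis \<Rightarrow> basis \<Rightarrow> ramond" where
  "basis_bracket (L m) (L n) =
     Poly_Mapping.single (L (m + n)) (of_int (m - n)) + central (m + n) (of_int (m ^ 3 - m) / 12)"
| "basis_bracket (L m) (H n) = Poly_Mapping.single (H (m + n)) (- of_int n)"
| "basis_bracket (H n) (L m) = Poly_Mapping.single (H (m + n)) (of_int n)"
| "basis_bracket (H m) (H n) = central (m + n) (of_int m / 3)"
| "basis_bracket (L m) (Gplus r) = Poly_Mapping.single (Gplus (m + r)) (of_int m / 2 - of_int r)"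
| "basis_bracket (L m) (Gminus r) = Poly_Mapping.single (Gminus (m + r)) (of_int m / 2 - of_int r)"
| "basis_bracket (Gplus r) (L m) = - Poly_Mapping.single (Gplus (m + r)) (of_int m / 2 - of_int r)"
| "basis_bracket (Gminus r) (L m) = - Poly_Mapping.single (Gminus (m + r)) (of_int m / 2 - of_int r)"
| "basis_bracket (H m) (Gplus r) = Poly_Mapping.single (Gplus (m + r)) 1"
| "basis_bracket (H m) (Gminus r) = - Poly_Mapping.single (Gminus (m + r)) 1"
| "basis_bracket (Gplus r) (H m) = - Poly_Mapping.single (Gplus (m + r)) 1"
| "basis_bracket (Gminus r) (H m) = Poly_Mapping.single (Gminus (m + r)) 1"
| "basis_bracket (Gminus r) (Gplus s) =
     Poly_Mapping.single (L (r + s)) 2 - Poly_Mapping.single (H (r + s)) (of_int (r - s))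
       + central (r + s) ((of_int r ^ 2 - 1 / 4) / 3)"
| "basis_bracket (Gplus s) (Gminus r) =
     Poly_Mapping.single (L (r + s)) 2 - Poly_Mapping.single (H (r + s)) (of_int (r - s))
       + central (r + s) ((of_int r ^ 2 - 1 / 4) / 3)"
| "basis_bracket (Gplus r) (Gplus s) = 0"
| "basis_bracket (Gminus r) (Gminus s) = 0"
| "basis_bracket Cent b = 0"
| "basis_bracket b Cent = 0"

definition ramond_bracket :: "ramond \<Rightarrow> ramond \<Rightarrow> ramond" where
  "ramond_bracket u v =
     linear_extension cscale (\<lambda>b. linear_extension cscale (basis_bracket b) v) u"

lemma lookup_cscale [simp]: "Poly_Mapping.lookup (cscale c u) i = c * Poly_Mapping.lookup u i"
  by (simp add: cscale_def map.rep_eq when_def)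

lemma cscale_single [simp]: "cscale c (Poly_Mapping.single i x) = Poly_Mapping.single i (c * x)"
  by (simp add: cscale_def)

lemma vector_space_cscale: "vector_space cscale"
  by unfold_locales (auto intro!: poly_mapping_eqI simp: lookup_add algebra_simps)

interpretation cs: vector_space cscale
  by (rule vector_space_cscale)

lemma linear_extension_superset:
  assumes "vector_space sc" "finite A" "Poly_Mapping.keys u \<subseteq> A"
  shows "linear_extension sc f u = (\<Sum>i\<in>A. sc (Poly_Mapping.lookup u i) (f i))"
proof -
  interpret vector_space sc by fact
  show ?thesis unfolding linear_extension_def
    using assms(2,3) by (intro sum.mono_neutral_left) (auto simp: in_keys_iff)
qed

lemma linear_linear_extension:
  assumes "vector_space sc"
  shows "Vector_Spaces.linear cscale sc (linear_extension sc f)"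
proof -
  interpret vector_space sc by fact
  note sup = linear_extension_superset[OF assms]
  show ?thesis
  proof unfold_locales
    fix u v :: "'b \<Rightarrow>\<^sub>0 complex" and c
    let ?A = "Poly_Mapping.keys u \<union> Poly_Mapping.keys v"
    show "linear_extension sc f (u + v) = linear_extension sc f u + linear_extension sc f v"
      using sup[of ?A u f] sup[of ?A v f] sup[of ?A "u + v" f] Poly_Mapping.keys_add[of u v]
      by (simp add: lookup_add scale_left_distrib sum.distrib)
    have "Poly_Mapping.keys (cscale c u) \<subseteq> Poly_Mapping.keys u"
      by (auto simp: in_keys_iff)
    then show "linear_extension sc f (cscale c u) = sc c (linear_extension sc f u)"
      using sup[of "Poly_Mapping.keys u" u f] sup[of "Poly_Mapping.keys u" "cscale c u" f]
      by (simp add: scale_sum_right)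
  qed
qed

lemma linear_extension_single:
  assumes "vector_space sc"
  shows "linear_extension sc f (Poly_Mapping.single i c) = sc c (f i)"
proof -
  interpret vector_space sc by fact
  show ?thesis using linear_extension_superset[OF assms, of "{i}" "Poly_Mapping.single i c" f]
    by simp
qed

lemma linear_eq_on_keys:
  assumes f: "Vector_Spaces.linear cscale sc f" and g: "Vector_Spaces.linear cscale sc g"
    and eq: "\<And>b. b \<in> Poly_Mapping.keys u \<Longrightarrow>
               f (Poly_Mapping.single b 1) = g (Poly_Mapping.single b 1)"
  shows "f u = g u"
proof -
  interpret f: Vector_Spaces.linear cscale sc f by fact
  interpret g: Vector_Spaces.linear cscale sc g by fact
  have u: "u = (\<Sum>b\<in>Poly_Mapping.keys u. cscale (Poly_Mapping.lookup u b) (Poly_Mapping.single b 1))"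
    by (rule poly_mapping_eqI)
      (auto simp: lookup_sum lookup_single when_def in_keys_iff if_distrib[of "(*) _"] cong: if_cong)
  have "f u = (\<Sum>b\<in>Poly_Mapping.keys u. sc (Poly_Mapping.lookup u b) (f (Poly_Mapping.single b 1)))"
    by (subst u) (simp only: f.sum f.scale)
  also have "\<dots> = (\<Sum>b\<in>Poly_Mapping.keys u. sc (Poly_Mapping.lookup u b) (g (Poly_Mapping.single b 1)))"
    using eq by (intro sum.cong) auto
  also have "\<dots> = g (\<Sum>b\<in>Poly_Mapping.keys u. cscale (Poly_Mapping.lookup u b) (Poly_Mapping.single b 1))"
    by (simp only: g.sum g.scale)
  also have "\<dots> = g u"
    using u by simp
  finally show ?thesis .
qed

lemma bracket_linear_left: "Vector_Spaces.linear cscale cscale (\<lambda>u. ramond_bracket u v)"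
  unfolding ramond_bracket_def by (rule linear_linear_extension[OF vector_space_cscale])

lemma bracket_linear_right: "Vector_Spaces.linear cscale cscale (ramond_bracket u)"
proof -
  interpret A: Vector_Spaces.linear cscale cscale "linear_extension cscale (basis_bracket b)" for b
    by (rule linear_linear_extension[OF vector_space_cscale])
  show ?thesis
    by unfold_locales
      (simp_all add: ramond_bracket_def linear_extension_def[of _ _ u] A.add A.scale sum.distrib
        cs.scale_right_distrib cs.scale_sum_right mult.commute)
qed

interpretation bl: Vector_Spaces.linear cscale cscale "\<lambda>u. ramond_bracket u v" for v
  by (rule bracket_linear_left)
interpretation br: Vector_Spaces.linear cscale cscale "ramond_bracket u" for u
  by (rule bracket_linear_right)

lemma bracket_single:
  "ramond_bracket (Poly_Mapping.single b x) (Poly_Mapping.single c y)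
     = cscale (x * y) (basis_bracket b c)"
  by (simp add: ramond_bracket_def linear_extension_single vector_space_cscale)

lemmas bracket_simps = bl.add br.add bl.diff br.diff bl.neg br.neg bl.scale br.scale
  bl.zero br.zero bracket_single

lemma ramond_subspace: "cs.subspace (ramond_part i)"
  unfolding cs.subspace_def ramond_part_def in_keys_iff Ball_def
  by (simp add: lookup_add) (metis add_0)

lemma single_in_ramond_part:
  "parity b = i \<Longrightarrow> Poly_Mapping.single b x \<in> ramond_part i"
  by (simp add: ramond_part_def)

lemma basis_bracket_parity: "basis_bracket b c \<in> ramond_part (parity b + parity c)"
  by (cases b; cases c)
    (simp_all add: central_def cs.subspace_add cs.subspace_diff cs.subspace_neg cs.subspace_0
      ramond_subspace single_in_ramond_part)

lemma lookup_central:
  "Poly_Mapping.lookup (central k c) i = (if i = Cent \<and> k = 0 then c else 0)"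
  by (auto simp: central_def lookup_single when_def)

lemma cscale_central: "cscale a (central k c) = central k (a * c)"
  by (auto intro!: poly_mapping_eqI simp: lookup_central)

lemma bracket_central:
  "ramond_bracket u (central k c) = 0" "ramond_bracket (central k c) u = 0"
proof -
  have "basis_bracket b Cent = 0" "basis_bracket Cent b = 0" for b by (cases b; simp)+
  then show "ramond_bracket u (central k c) = 0" "ramond_bracket (central k c) u = 0"
    unfolding ramond_bracket_def central_def linear_extension_single[OF vector_space_cscale]
    by (simp_all add: linear_extension_def)
qed

lemmas lookup_simps = lookup_add lookup_minus lookup_single lookup_central when_def

lemma basis_skew:
  "basis_bracket b c = - cscale (koszul_sign (parity b) (parity c)) (basis_bracket c b)"
  apply (cases b; cases c)
  apply (simp_all add: koszul_sign_def cs.scale_minus_left single_uminus)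
  apply (auto intro!: poly_mapping_eqI simp: lookup_simps add.commute field_simps add_eq_0_iff)
  done

lemma basis_jacobi:
  "ramond_bracket (Poly_Mapping.single b 1) (basis_bracket c d)
     = ramond_bracket (basis_bracket b c) (Poly_Mapping.single d 1)
       + cscale (koszul_sign (parity b) (parity c))
           (ramond_bracket (Poly_Mapping.single c 1) (basis_bracket b d))"
  apply (cases b; cases c; cases d)
  apply (simp_all add: koszul_sign_def cs.scale_minus_left single_uminus bracket_simps cscale_central
     bracket_central cs.scale_right_distrib cs.scale_right_diff_distrib)
  apply (auto intro!: poly_mapping_eqI simp: lookup_simps algebra_simps)
  apply ((((drule eq_neg_iff_add_eq_0[THEN iffD2])?, clarify?,
    simp add: field_simps power2_eq_square power3_eq_cube); fail)+)
  done

lemma ramond_partD: "u \<in> ramond_part i \<Longrightarrow> b \<in> Poly_Mapping.keys u \<Longrightarrow> parity b = i"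
  by (simp add: ramond_part_def)

lemma ramond_skew:
  assumes "u \<in> ramond_part i" "v \<in> ramond_part j"
  shows "ramond_bracket u v = - cscale (koszul_sign i j) (ramond_bracket v u)"
proof (rule linear_eq_on_keys[where u = u])
  show "Vector_Spaces.linear cscale cscale (\<lambda>u. - cscale (koszul_sign i j) (ramond_bracket v u))"
    by unfold_locales (simp_all add: bracket_simps cs.scale_right_distrib mult.commute)
  fix b assume b: "b \<in> Poly_Mapping.keys u"
  show "ramond_bracket (Poly_Mapping.single b 1) v =
      - cscale (koszul_sign i j) (ramond_bracket v (Poly_Mapping.single b 1))"
  proof (rule linear_eq_on_keys[where u = v])
    show "Vector_Spaces.linear cscale cscale
      (\<lambda>v. - cscale (koszul_sign i j) (ramond_bracket v (Poly_Mapping.single b 1)))"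
      by unfold_locales (simp_all add: bracket_simps cs.scale_right_distrib mult.commute)
    fix c assume c: "c \<in> Poly_Mapping.keys v"
    show "ramond_bracket (Poly_Mapping.single b 1) (Poly_Mapping.single c 1) =
      - cscale (koszul_sign i j) (ramond_bracket (Poly_Mapping.single c 1) (Poly_Mapping.single b 1))"
      using basis_skew[of b c] ramond_partD[OF assms(1) b] ramond_partD[OF assms(2) c]
      by (simp add: bracket_single)
  qed (rule bracket_linear_right)
qed (rule bracket_linear_left)

lemma ramond_jacobi:
  assumes "u \<in> ramond_part i" "v \<in> ramond_part j"
  shows "ramond_bracket u (ramond_bracket v w) =
    ramond_bracket (ramond_bracket u v) w
      + cscale (koszul_sign i j) (ramond_bracket v (ramond_bracket u w))"
proof (rule linear_eq_on_keys[where u = u])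
  fix b assume b: "b \<in> Poly_Mapping.keys u"
  let ?b = "Poly_Mapping.single b 1"
  show "ramond_bracket ?b (ramond_bracket v w) =
      ramond_bracket (ramond_bracket ?b v) w
        + cscale (koszul_sign i j) (ramond_bracket v (ramond_bracket ?b w))"
  proof (rule linear_eq_on_keys[where u = v])
    fix c assume c: "c \<in> Poly_Mapping.keys v"
    let ?c = "Poly_Mapping.single c 1"
    show "ramond_bracket ?b (ramond_bracket ?c w) =
      ramond_bracket (ramond_bracket ?b ?c) w
        + cscale (koszul_sign i j) (ramond_bracket ?c (ramond_bracket ?b w))"
    proof (rule linear_eq_on_keys[where u = w])
      fix d :: basis
      let ?d = "Poly_Mapping.single d 1"
      show "ramond_bracket ?b (ramond_bracket ?c ?d) =
        ramond_bracket (ramond_bracket ?b ?c) ?d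
          + cscale (koszul_sign i j) (ramond_bracket ?c (ramond_bracket ?b ?d))"
        using basis_jacobi[of b c d] ramond_partD[OF assms(1) b] ramond_partD[OF assms(2) c]
        by (simp add: bracket_single)
    qed (unfold_locales; simp add: bracket_simps cs.scale_right_distrib mult.commute)+
  qed (unfold_locales; simp add: bracket_simps cs.scale_right_distrib mult.commute)+
qed (unfold_locales; simp add: bracket_simps cs.scale_right_distrib mult.commute)+

lemma ramond_graded:
  assumes "u \<in> ramond_part i" "v \<in> ramond_part j"
  shows "ramond_bracket u v \<in> ramond_part (i + j)"
  unfolding ramond_bracket_def linear_extension_def
  using basis_bracket_parity ramond_partD[OF assms(1)] ramond_partD[OF assms(2)]
  by (intro cs.subspace_sum cs.subspace_scale ramond_subspace) metis

lemma ramond_direct_sum: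
  "\<exists>!p. fst p \<in> ramond_part 0 \<and> snd p \<in> ramond_part 1 \<and> v = fst p + snd p"
proof (rule ex_ex1I)
  define w where "w i = (\<Sum>b\<in>{b \<in> Poly_Mapping.keys v. parity b = i}.
    Poly_Mapping.single b (Poly_Mapping.lookup v b))" for i
  have w: "Poly_Mapping.lookup (w i) b = (if parity b = i then Poly_Mapping.lookup v b else 0)" for i b
    by (auto simp: w_def lookup_sum lookup_single when_def in_keys_iff)
  have "v = w 0 + w 1"
    by (rule poly_mapping_eqI) (simp add: lookup_add w)
  moreover have "w i \<in> ramond_part i" for i
    by (auto simp: ramond_part_def in_keys_iff w split: if_splits)
  ultimately show "\<exists>p. fst p \<in> ramond_part 0 \<and> snd p \<in> ramond_part 1 \<and> v = fst p + snd p"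
    by (intro exI[of _ "(w 0, w 1)"]) simp
next
  fix p q
  assume p: "fst p \<in> ramond_part 0 \<and> snd p \<in> ramond_part 1 \<and> v = fst p + snd p"
    and q: "fst q \<in> ramond_part 0 \<and> snd q \<in> ramond_part 1 \<and> v = fst q + snd q"
  have z: "Poly_Mapping.lookup u b = 0" if "u \<in> ramond_part i" "parity b \<noteq> i" for u i b
    using that by (auto simp: ramond_part_def in_keys_iff)
  have eq: "Poly_Mapping.lookup (fst p) b + Poly_Mapping.lookup (snd p) b =
      Poly_Mapping.lookup (fst q) b + Poly_Mapping.lookup (snd q) b" for b
    using p q by (metis lookup_add)
  have "fst p = fst q"
  proof (rule poly_mapping_eqI)
    fix b show "Poly_Mapping.lookup (fst p) b = Poly_Mapping.lookup (fst q) b"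
      using eq[of b] z[of _ 0 b] z[of _ 1 b] p q by (cases "parity b") auto
  qed
  then show "p = q" using p q by (metis add_left_cancel prod.expand)
qed

interpretation ramond: lie_superalgebra cscale ramond_part ramond_bracket
proof (rule lie_superalgebra.intro)
  show "super_vector_space cscale ramond_part"
    by (intro super_vector_space.intro vector_space_cscale super_vector_space_axioms.intro
      ramond_subspace ramond_direct_sum)
  show "lie_superalgebra_axioms cscale ramond_part ramond_bracket"
    by (rule lie_superalgebra_axioms.intro)
      (fact bracket_linear_left bracket_linear_right ramond_graded ramond_skew ramond_jacobi)+
qed


section \<open>The modules $S(\lambda,\alpha,a)$\<close>

text \<open>A pair \<open>(f, g)\<close> stands for $f(x) + g(s)$ in the direct sum of the even part, the polynomials
  in $x$, and the odd part, the polynomials in $s$.\<close>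

type_synonym S_space = "complex poly \<times> complex poly"

definition S_scale :: "complex \<Rightarrow> S_space \<Rightarrow> S_space" where
  "S_scale c p = (smult c (fst p), smult c (snd p))"

definition S_part :: "bit \<Rightarrow> S_space set" where
  "S_part i = (if i = 0 then {p. snd p = 0} else {p. fst p = 0})"

definition shift :: "int \<Rightarrow> complex poly \<Rightarrow> complex poly" where
  "shift m f = pcompose f [:of_int m, 1:]"

fun S_basis_act :: "complex \<Rightarrow> complex \<Rightarrow> complex \<Rightarrow> basis \<Rightarrow> S_space \<Rightarrow> S_space" where
  "S_basis_act lam \<alpha> a (L m) (f, g) =
     (smult (lam powi m) ([:- (of_int m * a / 2), 1:] * shift m f),
      smult (lam powi m) ([:- (of_int m * a / 2) + of_int m / 2, 1:] * shift m g))"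
| "S_basis_act lam \<alpha> a (H m) (f, g) =
     (smult (- a * lam powi m) (shift m f), smult (- (a + 1) * lam powi m) (shift m g))"
| "S_basis_act lam \<alpha> a (Gplus m) (f, g) =
     (smult (lam powi m * (2 / \<alpha>)) ([:- (of_int m * a), 1:] * shift m g), 0)"
| "S_basis_act lam \<alpha> a (Gminus m) (f, g) = (0, smult (lam powi m * \<alpha>) (shift m f))"
| "S_basis_act lam \<alpha> a Cent (f, g) = (0, 0)"

definition S :: "complex \<Rightarrow> complex \<Rightarrow> complex \<Rightarrow> (ramond, S_space) supermodule" where
  "S lam \<alpha> a =
     \<lparr> scal = S_scale,
       part = S_part,
       act = (\<lambda>u p. linear_extension S_scale (\<lambda>b. S_basis_act lam \<alpha> a b p) u) \<rparr>"

interpretation ss: vector_space S_scale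
  by unfold_locales (auto simp: S_scale_def smult_add_right smult_add_left)

lemma poly_shift [simp]: "poly (shift m f) x = poly f (x + of_int m)"
  by (simp add: shift_def poly_pcompose add.commute)

lemma shift_0 [simp]: "shift m 0 = 0"
  by (simp add: shift_def)

lemma poly_pointwise_eqI:
  fixes f g :: "complex poly"
  shows "(\<And>x. poly f x = poly g x) \<Longrightarrow> f = g"
  by (auto simp: poly_eq_poly_eq_iff[symmetric])

lemma S_super_vector_space: "super_vector_space S_scale S_part"
  apply unfold_locales
  apply (auto simp: S_part_def S_scale_def ss.subspace_def plus_prod_def)[]
  subgoal for v
    by (rule ex1I[of _ "((fst v, 0), (0, snd v))"]) (auto simp: S_part_def prod_eq_iff)
  done

lemma S_basis_act_add:
  "S_basis_act lam \<alpha> a b (p + q) = S_basis_act lam \<alpha> a b p + S_basis_act lam \<alpha> a b q"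
  by (cases p; cases q; cases b)
    (auto intro!: poly_pointwise_eqI simp: algebra_simps simp del: mult_pCons_left mult_pCons_right)

lemma S_basis_act_scale:
  "S_basis_act lam \<alpha> a b (S_scale c p) = S_scale c (S_basis_act lam \<alpha> a b p)"
  by (cases p; cases b)
    (auto intro!: poly_pointwise_eqI simp: S_scale_def algebra_simps simp del: mult_pCons_left mult_pCons_right)

interpretation sa: Vector_Spaces.linear S_scale S_scale "S_basis_act lam \<alpha> a b" for lam \<alpha> a b
  by unfold_locales (rule S_basis_act_add S_basis_act_scale)+

lemma S_basis_graded:
  "p \<in> S_part j \<Longrightarrow> S_basis_act lam \<alpha> a b p \<in> S_part (parity b + j)"
  by (cases p; cases b; cases j) (auto simp: S_part_def)

lemma S_act_linear_left:
  "Vector_Spaces.linear cscale S_scale (\<lambda>u. act (S lam \<alpha> a) u p)"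
  unfolding S_def by (simp add: linear_linear_extension[OF ss.vector_space_axioms])

lemma S_act_linear_right: "Vector_Spaces.linear S_scale S_scale (act (S lam \<alpha> a) u)"
  by unfold_locales
    (simp_all add: S_def linear_extension_def sa.add sa.scale sum.distrib
      ss.scale_right_distrib ss.scale_sum_right mult.commute)

interpretation al: Vector_Spaces.linear cscale S_scale "\<lambda>u. act (S lam \<alpha> a) u p" for lam \<alpha> a p
  by (rule S_act_linear_left)
interpretation ar: Vector_Spaces.linear S_scale S_scale "act (S lam \<alpha> a) u" for lam \<alpha> a u
  by (rule S_act_linear_right)

lemma S_act_single:
  "act (S lam \<alpha> a) (Poly_Mapping.single b c) p = S_scale c (S_basis_act lam \<alpha> a b p)"
  by (simp add: S_def linear_extension_single ss.vector_space_axioms)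

lemma S_act_central: "act (S lam \<alpha> a) (central k c) p = 0"
  by (cases p) (simp add: central_def S_act_single zero_prod_def S_scale_def)

lemmas act_simps = al.add al.diff al.neg al.scale al.zero ar.add ar.diff ar.neg ar.scale ar.zero
  S_act_single S_act_central

lemma S_basis_bracket:
  assumes "lam \<noteq> 0" "\<alpha> \<noteq> 0"
  shows "act (S lam \<alpha> a) (basis_bracket b c) p =
    S_basis_act lam \<alpha> a b (S_basis_act lam \<alpha> a c p)
    - S_scale (koszul_sign (parity b) (parity c))
        (S_basis_act lam \<alpha> a c (S_basis_act lam \<alpha> a b p))"
proof -
  obtain f g where p: "p = (f, g)" by (cases p)
  note [simp del] = mult_pCons_left mult_pCons_right
  show ?thesis unfolding p using assms
    apply (cases b; cases c)
    apply (simp_all add: koszul_sign_def act_simps S_scale_def)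
    apply (auto intro!: poly_pointwise_eqI simp: zero_prod_def power_int_add field_simps)
    done
qed

lemma S_act_bracket:
  assumes "lam \<noteq> 0" "\<alpha> \<noteq> 0" "u \<in> ramond_part i" "v \<in> ramond_part j"
  shows "act (S lam \<alpha> a) (ramond_bracket u v) p =
    act (S lam \<alpha> a) u (act (S lam \<alpha> a) v p)
    - S_scale (koszul_sign i j) (act (S lam \<alpha> a) v (act (S lam \<alpha> a) u p))"
proof (rule linear_eq_on_keys[where u = u])
  fix b assume b: "b \<in> Poly_Mapping.keys u"
  let ?b = "Poly_Mapping.single b 1"
  show "act (S lam \<alpha> a) (ramond_bracket ?b v) p =
    act (S lam \<alpha> a) ?b (act (S lam \<alpha> a) v p)
    - S_scale (koszul_sign i j) (act (S lam \<alpha> a) v (act (S lam \<alpha> a) ?b p))"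
  proof (rule linear_eq_on_keys[where u = v])
    fix c assume c: "c \<in> Poly_Mapping.keys v"
    let ?c = "Poly_Mapping.single c 1"
    show "act (S lam \<alpha> a) (ramond_bracket ?b ?c) p =
      act (S lam \<alpha> a) ?b (act (S lam \<alpha> a) ?c p)
      - S_scale (koszul_sign i j) (act (S lam \<alpha> a) ?c (act (S lam \<alpha> a) ?b p))"
      using S_basis_bracket[OF assms(1,2), of a b c p]
        ramond_partD[OF assms(3) b] ramond_partD[OF assms(4) c]
      by (simp add: bracket_single act_simps)
  qed (unfold_locales; simp add: bracket_simps act_simps ss.scale_right_distrib
        ss.scale_right_diff_distrib mult.commute)+
qed (unfold_locales; simp add: bracket_simps act_simps ss.scale_right_distrib
      ss.scale_right_diff_distrib mult.commute)+

theorem S_supermodule: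
  assumes "lam \<noteq> 0" "\<alpha> \<noteq> 0"
  shows "lie_supermodule cscale ramond_part ramond_bracket (S lam \<alpha> a)"
proof (intro lie_supermodule.intro lie_supermodule_axioms.intro)
  show "lie_superalgebra cscale ramond_part ramond_bracket"
    by (rule ramond.lie_superalgebra_axioms)
  have [simp]: "scal (S lam \<alpha> a) = S_scale" "part (S lam \<alpha> a) = S_part"
    by (simp_all add: S_def)
  show "super_vector_space (scal (S lam \<alpha> a)) (part (S lam \<alpha> a))"
    by (simp add: S_super_vector_space)
  show "Vector_Spaces.linear cscale (scal (S lam \<alpha> a)) (\<lambda>u. act (S lam \<alpha> a) u v)" for v
    by (simp add: S_act_linear_left)
  show "Vector_Spaces.linear (scal (S lam \<alpha> a)) (scal (S lam \<alpha> a)) (act (S lam \<alpha> a) u)" for u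
    by (simp add: S_act_linear_right)
  show "act (S lam \<alpha> a) u v \<in> part (S lam \<alpha> a) (i + j)"
    if "u \<in> ramond_part i" "v \<in> part (S lam \<alpha> a) j" for u v i j
  proof -
    have sub: "ss.subspace (S_part k)" for k
      using S_super_vector_space by (rule super_vector_space.subspace_part)
    have "S_scale (Poly_Mapping.lookup u b) (S_basis_act lam \<alpha> a b v) \<in> S_part (i + j)"
      if "b \<in> Poly_Mapping.keys u" for b
      using S_basis_graded[of v j lam \<alpha> a b] ramond_partD[OF \<open>u \<in> ramond_part i\<close> that]
        \<open>v \<in> part (S lam \<alpha> a) j\<close>
      by (simp add: ss.subspace_scale[OF sub])
    then have "linear_extension S_scale (\<lambda>b. S_basis_act lam \<alpha> a b v) u \<in> S_part (i + j)"
      unfolding linear_extension_def by (rule ss.subspace_sum[OF sub])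
    then show ?thesis
      by (simp only: S_def supermodule.simps)
  qed
  show "act (S lam \<alpha> a) (ramond_bracket u u') v =
      act (S lam \<alpha> a) u (act (S lam \<alpha> a) u' v)
      - scal (S lam \<alpha> a) (koszul_sign i j) (act (S lam \<alpha> a) u' (act (S lam \<alpha> a) u v))"
    if "u \<in> ramond_part i" "u' \<in> ramond_part j" for u u' v i j
    using S_act_bracket[OF assms that] by simp
qed

end

theory Submission
  imports Defs
begin

text \<open>An isomorphism sends the constant 1 in the even part to some nonzero even polynomial \<open>p\<close>, and
  \<open>x\<close>, which is \<open>L\<^sub>0 1\<close>, to \<open>x p\<close>. Comparing the two actions of \<open>H\<^sub>0\<close> on 1 gives \<open>a = b\<close>, and
  comparing leading coefficients in the two actions of \<open>L\<^sub>1\<close> on 1 gives equality of the other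
  parameters. Conversely, \<open>\<alpha>\<close> can be changed to \<open>\<beta>\<close> by rescaling the odd part.\<close>

lemma S_sel [simp]: "scal (S lam \<alpha> a) = S_scale" "part (S lam \<alpha> a) = S_part"
  by (simp_all add: S_def)

text \<open>A shift is composition with a monic linear polynomial. This permits comparing leading
  coefficients without knowing the degree of \<open>f\<close>.\<close>

lemma lead_coeff_shift: "lead_coeff (shift m f) = lead_coeff f"
  by (simp add: shift_def lead_coeff_comp)

lemma S_isomorphic_imp:
  assumes "ramond.isomorphic (S lam \<alpha> a) (S \<mu> \<beta> b)"
  shows "lam = \<mu> \<and> a = b"
proof -
  obtain \<phi> where lin: "Vector_Spaces.linear S_scale S_scale \<phi>" and bij: "bij \<phi>"
    and part: "\<And>i. \<phi> ` S_part i = S_part i"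
    and act: "\<And>u v. \<phi> (act (S lam \<alpha> a) u v) = act (S \<mu> \<beta> b) u (\<phi> v)"
    using assms unfolding ramond.isomorphic_def by auto
  interpret \<phi>: Vector_Spaces.linear S_scale S_scale \<phi> by (rule lin)
  have basis: "\<phi> (S_basis_act lam \<alpha> a c v) = S_basis_act \<mu> \<beta> b c (\<phi> v)" for c v
    using act[of "Poly_Mapping.single c 1" v] by (simp add: S_act_single)
  define p where "p = fst (\<phi> (1, 0))"
  have "\<phi> (1, 0) \<in> S_part 0"
    using part[of 0] by (force simp: S_part_def)
  then have \<phi>1: "\<phi> (1, 0) = (p, 0)"
    by (simp add: p_def S_part_def prod_eq_iff)
  have "\<phi> (1, 0) \<noteq> \<phi> 0"
    using bij by (simp add: bij_def inj_eq zero_prod_def)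
  then have p: "p \<noteq> 0"
    by (metis \<phi>1 \<phi>.zero zero_prod_def)
  have sh: "shift m 1 = 1" "shift 0 f = f" for m f
    by (auto intro!: poly_pointwise_eqI)
  have \<phi>x: "\<phi> ([:0, 1:], 0) = ([:0, 1:] * p, 0)"
    using basis[of "L 0" "(1, 0)"] by (simp add: \<phi>1 sh)
  \<comment> \<open>\<open>H 0\<close> acts on the even part as a scalar: \<open>- a\<close> in the
    source, \<open>- b\<close> in the target.\<close>
  have "S_basis_act lam \<alpha> a (H 0) (1, 0) = S_scale (- a) (1, 0)"
    by (simp add: S_scale_def sh)
  then have "S_scale (- a) (p, 0) = S_basis_act \<mu> \<beta> b (H 0) (p, 0)"
    using basis[of "H 0" "(1, 0)"] by (simp only: \<phi>1 \<phi>.scale)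
  then have "smult (b - a) p = 0"
    by (simp add: S_scale_def sh smult_diff_left)
  then have ab: "a = b"
    using p by simp
  \<comment> \<open>Written as a combination of \<open>x\<close> and 1, the two vectors whose images
    under \<open>\<phi>\<close> are known.\<close>
  have "S_basis_act lam \<alpha> a (L 1) (1, 0) =
      S_scale lam (([:0, 1:], 0) + S_scale (- (a / 2)) (1, 0))"
    by (simp add: S_scale_def sh)
  then have "S_scale lam (([:0, 1:] * p, 0) + S_scale (- (a / 2)) (p, 0)) =
      S_basis_act \<mu> \<beta> b (L 1) (p, 0)"
    using basis[of "L 1" "(1, 0)"] by (simp only: \<phi>1 \<phi>x \<phi>.scale \<phi>.add)
  then have "smult lam ([:- (a / 2), 1:] * p) = smult \<mu> ([:- (b / 2), 1:] * shift 1 p)"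
    by (simp add: S_scale_def)
  \<comment> \<open>Both linear factors are monic, so only the outer scalars remain in front of
    \<open>lead_coeff p\<close>.\<close>
  then have "lam * lead_coeff p = \<mu> * lead_coeff p"
    by (metis lead_coeff_smult lead_coeff_mult lead_coeff_pCons(1) lead_coeff_1 one_neq_zero
        lead_coeff_shift mult_1 one_pCons)
  then show ?thesis
    using p ab by simp
qed

text \<open>Only the odd generators involve \<open>\<alpha>\<close>: \<open>Gminus\<close>
  multiplies by it on entering the odd part, \<open>Gplus\<close> divides by it on leaving. The
  factor \<open>\<beta> / \<alpha>\<close> on the odd part corrects both at once.\<close>

lemma S_isomorphic_rescale:
  assumes "lam \<noteq> 0" "\<alpha> \<noteq> 0" "\<beta> \<noteq> 0"
  shows "ramond.isomorphic (S lam \<alpha> a) (S lam \<beta> a)"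
proof -
  define \<phi> :: "S_space \<Rightarrow> S_space" where "\<phi> v = (fst v, smult (\<beta> / \<alpha>) (snd v))" for v
  define \<psi> :: "S_space \<Rightarrow> S_space" where "\<psi> v = (fst v, smult (\<alpha> / \<beta>) (snd v))" for v
  have inv: "\<phi> (\<psi> v) = v" "\<psi> (\<phi> v) = v" for v
    using assms by (simp_all add: \<phi>_def \<psi>_def)
  have lin: "Vector_Spaces.linear S_scale S_scale \<phi>"
    by unfold_locales (simp_all add: \<phi>_def S_scale_def smult_add_right mult.commute)
  have \<phi>_part: "\<phi> v \<in> S_part i" and \<psi>_part: "\<psi> v \<in> S_part i" if "v \<in> S_part i" for v i
    using that by (auto simp: S_part_def \<phi>_def \<psi>_def split: if_splits)
  have part: "\<phi> ` S_part i = S_part i" for i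
    using \<phi>_part \<psi>_part inv(1) by (metis image_eqI image_subsetI subsetI subset_antisym)
  have basis: "\<phi> (S_basis_act lam \<alpha> a c v) = S_basis_act lam \<beta> a c (\<phi> v)" for c v
    using assms by (cases v; cases c)
      (auto intro!: poly_pointwise_eqI simp: \<phi>_def field_simps
        simp del: mult_pCons_left mult_pCons_right)
  \<comment> \<open>Both sides are linear in \<open>u\<close>, so \<open>basis\<close>
    suffices.\<close>
  have "\<phi> (act (S lam \<alpha> a) u v) = act (S lam \<beta> a) u (\<phi> v)" for u v
  proof (rule linear_eq_on_keys[where u = u])
    show "Vector_Spaces.linear cscale S_scale (\<lambda>u. \<phi> (act (S lam \<alpha> a) u v))"
      using Vector_Spaces.linear_compose[OF S_act_linear_left lin] by (simp add: o_def)
  qed (simp_all add: S_act_linear_left S_act_single basis)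
  moreover have "bij \<phi>"
    using inv by (intro o_bij[of \<psi>]) auto
  ultimately show ?thesis
    unfolding ramond.isomorphic_def using assms lin part
    by (intro conjI S_supermodule exI[of _ \<phi>]) simp_all
qed

theorem theorem3p14:
  fixes lam \<mu> \<alpha> \<beta> a b :: complex
  assumes "lam \<noteq> 0" "\<mu> \<noteq> 0" "\<alpha> \<noteq> 0" "\<beta> \<noteq> 0"
  shows "ramond.isomorphic (S lam \<alpha> a) (S \<mu> \<beta> b) \<longleftrightarrow> lam = \<mu> \<and> a = b"
  using S_isomorphic_imp S_isomorphic_rescale assms by blast

end
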